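(* Let $n,d_1,d_2$ be positive integers. If there exist a regular SMS$(n,d_1)$ and a regular SAMS$(n,d_2)$ which are compatible, then there exists a regular SAMS$(n,d_1+d_2)$.
   Context: For positive integers $n,d$ with $d<n$: an $n\times n$ array with entries in $\{0,1,\dots,nd\}$ in which each element of $\{1,\dots,nd\}$ occurs in exactly one entry (all other entries $0$) is a sparse magic square SMS$(n,d)$ if all row-sums, column-sums and the two main diagonal sums (entries $(i,i)$, resp. $(i,n+1-i)$) are equal; it is a sparse anti-magic square SAMS$(n,d)$ if these $2n+2$ sums form a set of $2n+2$ consecutive integers. Such a square is regular if every row, every column and both main diagonals contain exactly $d$ positive entries. For an $m\times n$ array $M=(m_{i,j})$ let $\Omega(M)=\{(i,j): m_{i,j}\neq 0\}$; two $m\times n$ arrays $M,N$ are compatible if $\Omega(M)\cap\Omega(N)=\emptyset$. *)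

theory Defs
  imports Main
begin

text \<open>
  An m-by-n array is a function \<open>A :: nat \<Rightarrow> nat \<Rightarrow> nat\<close>; only its values \<open>A i j\<close> with
  \<open>i \<in> {1..m}\<close> and \<open>j \<in> {1..n}\<close> matter. Indices start at 1, so the second main diagonal
  consists of the entries \<open>(i, n + 1 - i)\<close>.
\<close>

type_synonym array = "nat \<Rightarrow> nat \<Rightarrow> nat"

definition row_sum :: "nat \<Rightarrow> array \<Rightarrow> nat \<Rightarrow> nat" where
  "row_sum n A i = (\<Sum>j\<in>{1..n}. A i j)"

definition col_sum :: "nat \<Rightarrow> array \<Rightarrow> nat \<Rightarrow> nat" where
  "col_sum n A j = (\<Sum>i\<in>{1..n}. A i j)"

definition diag_sum :: "nat \<Rightarrow> array \<Rightarrow> nat" where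
  "diag_sum n A = (\<Sum>i\<in>{1..n}. A i i)"

definition antidiag_sum :: "nat \<Rightarrow> array \<Rightarrow> nat" where
  "antidiag_sum n A = (\<Sum>i\<in>{1..n}. A i (n + 1 - i))"

definition line_sums :: "nat \<Rightarrow> array \<Rightarrow> nat set" where
  "line_sums n A =
     row_sum n A ` {1..n} \<union> col_sum n A ` {1..n} \<union> {diag_sum n A, antidiag_sum n A}"

text \<open>
  The literature speaks of sparse squares of density \<open>d\<close> only for \<open>0 < d < n\<close>. This range is not
  part of the predicates below: a compatible pair of regular squares of positive densities
  \<open>d1\<close> and \<open>d2\<close> satisfies \<open>d1 + d2 \<le> n\<close>, hence \<open>d1 < n\<close> and \<open>d2 < n\<close>, but \<open>d1 + d2 = n\<close> is
  not excluded. For \<open>d = n\<close> the predicates describe ordinary (full) squares with entries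
  \<open>1, \<dots>, n * n\<close>.
\<close>

definition sparse_array :: "nat \<Rightarrow> nat \<Rightarrow> array \<Rightarrow> bool" where
  "sparse_array n d A \<longleftrightarrow>
     (\<forall>i\<in>{1..n}. \<forall>j\<in>{1..n}. A i j \<in> {0..n * d}) \<and>
     (\<forall>k\<in>{1..n * d}. \<exists>!p. p \<in> {1..n} \<times> {1..n} \<and> A (fst p) (snd p) = k)"

definition SMS :: "nat \<Rightarrow> nat \<Rightarrow> array \<Rightarrow> bool" where
  "SMS n d A \<longleftrightarrow> sparse_array n d A \<and> (\<exists>c. \<forall>s\<in>line_sums n A. s = c)"

text \<open>
  Since there are \<open>2 * n + 2\<close> lines, the condition on the set of line sums forces these sums to be
  pairwise distinct.
\<close>

definition SAMS :: "nat \<Rightarrow> nat \<Rightarrow> array \<Rightarrow> bool" where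
  "SAMS n d A \<longleftrightarrow> sparse_array n d A \<and> (\<exists>a. line_sums n A = {a..<a + (2 * n + 2)})"

definition regular :: "nat \<Rightarrow> nat \<Rightarrow> array \<Rightarrow> bool" where
  "regular n d A \<longleftrightarrow>
     (\<forall>i\<in>{1..n}. card {j\<in>{1..n}. A i j > 0} = d) \<and>
     (\<forall>j\<in>{1..n}. card {i\<in>{1..n}. A i j > 0} = d) \<and>
     card {i\<in>{1..n}. A i i > 0} = d \<and>
     card {i\<in>{1..n}. A i (n + 1 - i) > 0} = d"

definition Omega :: "nat \<Rightarrow> nat \<Rightarrow> array \<Rightarrow> (nat \<times> nat) set" where
  "Omega m n A = {(i, j). i \<in> {1..m} \<and> j \<in> {1..n} \<and> A i j \<noteq> 0}"

definition compatible :: "nat \<Rightarrow> nat \<Rightarrow> array \<Rightarrow> array \<Rightarrow> bool" where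
  "compatible m n A B \<longleftrightarrow> Omega m n A \<inter> Omega m n B = {}"

end

theory Submission imports Defs begin

text \<open>
  Adding \<open>n * d1\<close> to the positive entries of the anti-magic square and superimposing the magic one
  uses each of \<open>1, \<dots>, n * (d1 + d2)\<close> once. Every line sum of the anti-magic square grows by the
  same amount, the magic constant plus \<open>d2 * (n * d1)\<close>, because every line has exactly \<open>d2\<close>
  shifted entries.
\<close>

text \<open>The shift \<open>t\<close> must skip the zeros of \<open>N\<close>, since those cells
  are where the entries of \<open>M\<close> show through. Writing the result as a sum, not as a
  choice between the two entries, lets line sums split by additivity.\<close>

definition superimpose :: "nat \<Rightarrow> array \<Rightarrow> array \<Rightarrow> array" where
  "superimpose t M N i j = M i j + (if N i j > 0 then N i j + t else 0)"

text \<open>The maps \<open>f\<close> and \<open>g\<close> give the row and column index of a cell,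
  so that rows, columns and both diagonals are all instances. Each positive entry of
  \<open>N\<close> on the line contributes one extra \<open>t\<close>.\<close>

lemma sum_superimpose:
  assumes "finite I"
  shows "(\<Sum>x\<in>I. superimpose t M N (f x) (g x)) =
    (\<Sum>x\<in>I. M (f x) (g x)) + (\<Sum>x\<in>I. N (f x) (g x)) + card {x\<in>I. N (f x) (g x) > 0} * t"
proof -
  have "superimpose t M N (f x) (g x) =
      M (f x) (g x) + N (f x) (g x) + (if N (f x) (g x) > 0 then t else 0)" for x
    by (simp add: superimpose_def)
  moreover have "(\<Sum>x\<in>I. if N (f x) (g x) > 0 then t else 0) = card {x\<in>I. N (f x) (g x) > 0} * t"
    using assms by (simp add: sum.inter_filter[symmetric])
  ultimately show ?thesis
    by (simp only: sum.distrib)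
qed

lemma card_superimpose:
  assumes "finite I" "\<And>x. x \<in> I \<Longrightarrow> M (f x) (g x) = 0 \<or> N (f x) (g x) = 0"
  shows "card {x\<in>I. superimpose t M N (f x) (g x) > 0} =
    card {x\<in>I. M (f x) (g x) > 0} + card {x\<in>I. N (f x) (g x) > 0}"
proof -
  have "{x\<in>I. superimpose t M N (f x) (g x) > 0} =
      {x\<in>I. M (f x) (g x) > 0} \<union> {x\<in>I. N (f x) (g x) > 0}"
    by (auto simp: superimpose_def)
  then show ?thesis
    using assms by (simp only:) (intro card_Un_disjoint; fastforce)
qed

lemma compatible_iff:
  "compatible m n M N \<longleftrightarrow> (\<forall>i\<in>{1..m}. \<forall>j\<in>{1..n}. M i j = 0 \<or> N i j = 0)"
  unfolding compatible_def Omega_def disjoint_iff split_paired_All mem_Collect_eq case_prod_conv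
  by meson

lemma sparse_array_superimpose:
  assumes M: "sparse_array n d1 M" and N: "sparse_array n d2 N" and comp: "compatible n n M N"
  shows "sparse_array n (d1 + d2) (superimpose (n * d1) M N)" (is "sparse_array _ _ ?L")
  unfolding sparse_array_def
proof (intro conjI ballI)
  have zero: "M i j = 0 \<or> N i j = 0" and Mle: "M i j \<le> n * d1" and Nle: "N i j \<le> n * d2"
    if "i \<in> {1..n}" "j \<in> {1..n}" for i j
    using M N comp that by (auto simp: sparse_array_def compatible_iff)
  show "?L i j \<in> {0..n * (d1 + d2)}" if "i \<in> {1..n}" "j \<in> {1..n}" for i j
    using zero[OF that] Mle[OF that] Nle[OF that]
    by (auto simp: superimpose_def distrib_left)
  fix k assume k: "k \<in> {1..n * (d1 + d2)}"
  show "\<exists>!p. p \<in> {1..n} \<times> {1..n} \<and> ?L (fst p) (snd p) = k"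
  proof (cases "k \<le> n * d1")
    case True
    \<comment> \<open>A positive entry of \<open>N\<close> is shifted above \<open>n * d1\<close>,
      so it cannot produce this \<open>k\<close>. Its cell has \<open>M i j = 0\<close>, which
      differs from \<open>k\<close> because \<open>k\<close> is at least 1.\<close>
    have "?L i j = k \<longleftrightarrow> M i j = k" if "i \<in> {1..n}" "j \<in> {1..n}" for i j
      using zero[OF that] k True by (auto simp: superimpose_def)
    then have "p \<in> {1..n} \<times> {1..n} \<and> ?L (fst p) (snd p) = k \<longleftrightarrow>
        p \<in> {1..n} \<times> {1..n} \<and> M (fst p) (snd p) = k" for p
      by (metis mem_Times_iff)
    moreover have "k \<in> {1..n * d1}"
      using k True by simp
    ultimately show ?thesis
      using M by (simp only: sparse_array_def)
  next
    case False
    \<comment> \<open>Entries of \<open>M\<close> are too small to equal \<open>k\<close>, so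
      \<open>k\<close> can only come from a shifted entry. As \<open>k > n * d1\<close>, the
      truncated subtraction is exact and its result positive, so zeros of \<open>N\<close> do not
      match.\<close>
    have "?L i j = k \<longleftrightarrow> N i j = k - n * d1" if "i \<in> {1..n}" "j \<in> {1..n}" for i j
      using zero[OF that] Mle[OF that] False by (auto simp: superimpose_def)
    then have "p \<in> {1..n} \<times> {1..n} \<and> ?L (fst p) (snd p) = k \<longleftrightarrow>
        p \<in> {1..n} \<times> {1..n} \<and> N (fst p) (snd p) = k - n * d1" for p
      by (metis mem_Times_iff)
    moreover have "k - n * d1 \<in> {1..n * d2}"
      using k False by (auto simp: distrib_left)
    ultimately show ?thesis
      using N by (simp only: sparse_array_def)
  qed
qed

lemma regular_superimpose:
  assumes "regular n d1 M" "regular n d2 N" and comp: "compatible n n M N"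
  shows "regular n (d1 + d2) (superimpose t M N)"
proof -
  have zero: "M i j = 0 \<or> N i j = 0" if "i \<in> {1..n}" "j \<in> {1..n}" for i j
    using comp that by (auto simp: compatible_iff)
  have "card {j\<in>{1..n}. superimpose t M N i j > 0} =
      card {j\<in>{1..n}. M i j > 0} + card {j\<in>{1..n}. N i j > 0}" if "i \<in> {1..n}" for i
    using zero that by (intro card_superimpose[where f = "\<lambda>_. i" and g = "\<lambda>j. j"]) auto
  moreover have "card {i\<in>{1..n}. superimpose t M N i j > 0} =
      card {i\<in>{1..n}. M i j > 0} + card {i\<in>{1..n}. N i j > 0}" if "j \<in> {1..n}" for j
    using zero that by (intro card_superimpose[where f = "\<lambda>i. i" and g = "\<lambda>_. j"]) auto
  moreover have "card {i\<in>{1..n}. superimpose t M N i i > 0} =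
      card {i\<in>{1..n}. M i i > 0} + card {i\<in>{1..n}. N i i > 0}"
    using zero by (intro card_superimpose[where f = "\<lambda>i. i" and g = "\<lambda>i. i"]) auto
  moreover have "card {i\<in>{1..n}. superimpose t M N i (n + 1 - i) > 0} =
      card {i\<in>{1..n}. M i (n + 1 - i) > 0} + card {i\<in>{1..n}. N i (n + 1 - i) > 0}"
    \<comment> \<open>For \<open>i\<close> in \<open>{1..n}\<close> the column
      \<open>n + 1 - i\<close> again lies in \<open>{1..n}\<close>, so \<open>zero\<close> applies
      to the antidiagonal cells.\<close>
    by (intro card_superimpose[where f = "\<lambda>i. i" and g = "\<lambda>i. n + 1 - i"] zero) auto
  ultimately show ?thesis
    using assms(1,2) by (simp add: regular_def)
qed

text \<open>The result is phrased as an image under one translation so that an interval of line sums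
  goes to an interval of the same length.\<close>

lemma line_sums_superimpose:
  assumes M: "\<forall>s\<in>line_sums n M. s = c" and N: "regular n d N"
  shows "line_sums n (superimpose t M N) = (\<lambda>s. s + (c + d * t)) ` line_sums n N"
proof -
  have "row_sum n (superimpose t M N) i = row_sum n N i + (c + d * t)" if "i \<in> {1..n}" for i
    using M N that sum_superimpose[of "{1..n}" t M N "\<lambda>_. i" "\<lambda>j. j"]
    by (simp add: line_sums_def regular_def row_sum_def)
  moreover have "col_sum n (superimpose t M N) j = col_sum n N j + (c + d * t)"
    if "j \<in> {1..n}" for j
    using M N that sum_superimpose[of "{1..n}" t M N "\<lambda>i. i" "\<lambda>_. j"]
    by (simp add: line_sums_def regular_def col_sum_def ball_Un)
  moreover have "diag_sum n (superimpose t M N) = diag_sum n N + (c + d * t)"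
    using M N sum_superimpose[of "{1..n}" t M N "\<lambda>i. i" "\<lambda>i. i"]
    by (simp add: line_sums_def regular_def diag_sum_def)
  moreover have "antidiag_sum n (superimpose t M N) = antidiag_sum n N + (c + d * t)"
    using M N sum_superimpose[of "{1..n}" t M N "\<lambda>i. i" "\<lambda>i. n + 1 - i"]
    by (simp add: line_sums_def regular_def antidiag_sum_def)
  ultimately show ?thesis
    by (simp only: line_sums_def image_Un image_image image_insert image_empty cong: image_cong)
qed

theorem theorem4p4:
  fixes n d1 d2 :: nat
  assumes "n > 0" and "d1 > 0" and "d2 > 0"
    and "\<exists>M N. SMS n d1 M \<and> regular n d1 M \<and> SAMS n d2 N \<and> regular n d2 N \<and> compatible n n M N"
  shows "\<exists>L. SAMS n (d1 + d2) L \<and> regular n (d1 + d2) L"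
proof -
  obtain M N where M: "SMS n d1 M" "regular n d1 M" and N: "SAMS n d2 N" "regular n d2 N"
    and comp: "compatible n n M N"
    using assms(4) by blast
  let ?L = "superimpose (n * d1) M N"
  obtain c where c: "\<forall>s\<in>line_sums n M. s = c"
    using M(1) by (auto simp: SMS_def)
  obtain a where a: "line_sums n N = {a..<a + (2 * n + 2)}"
    using N(1) by (auto simp: SAMS_def)
  \<comment> \<open>Naming the common increment turns the image into a plain translation by
    \<open>b\<close>, the form that the interval lemma handles.\<close>
  define b where "b = c + d2 * (n * d1)"
  have "line_sums n ?L = {a + b..<a + b + (2 * n + 2)}"
    unfolding line_sums_superimpose[OF c N(2)] a b_def[symmetric]
    by (simp add: image_add_atLeastLessThan' add_ac del: One_nat_def)
  moreover have "sparse_array n (d1 + d2) ?L"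
    using M(1) N(1) comp by (simp add: SMS_def SAMS_def sparse_array_superimpose)
  ultimately have "SAMS n (d1 + d2) ?L"
    by (auto simp: SAMS_def)
  with regular_superimpose[OF M(2) N(2) comp] show ?thesis
    by blast
qed

end
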